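(* Let $G$ be a connected graph and let $D\subseteq V(G)$ be a connected $3$-way dominating set of $G$. Then $px_3(G)\le px_3(G[D])+3$. Moreover, this bound is tight: for every integer $p\ge 3$ and integers $i_1,\dots,i_p\ge 4$, the graph $G$ obtained from complete graphs $K_{i_1},\dots,K_{i_p}$ by identifying one vertex of each into a single common vertex $v_0$ has the connected $3$-way dominating set $D=\{v_0\}$ and satisfies $px_3(G)=3=px_3(G[D])+3$.
   Context: All graphs are finite, simple and undirected. For $D\subseteq V(G)$, $\overline{D}=V(G)\setminus D$ and $G[D]$ is the induced subgraph. A set $D$ is a dominating set if every vertex of $\overline{D}$ has a neighbor in $D$; it is a $3$-way dominating set if moreover every vertex $v\in\overline{D}$ has degree $d(v)\ge 3$ in $G$; it is connected if $G[D]$ is connected. An edge-coloring assigns colors to edges, adjacent edges being allowed to share a color. A tree in an edge-colored graph is a proper tree if no two adjacent edges of it receive the same color. For a set $S$ of vertices, an $S$-tree is a tree containing all vertices of $S$. An edge-coloring of a connected graph $H$ is a $3$-proper coloring if for every $3$-element subset $S\subseteq V(H)$ there is a proper $S$-tree in $H$; $px_3(H)$ is the minimum number of colors in such a coloring. For a connected graph $H$ with fewer than $3$ vertices, we use the convention that $px_3(H)$ is the minimum number of colors needed to color its edges so that any set of its vertices is contained in a proper tree (so $px_3(K_1)=0$, $px_3(K_2)=1$). *)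

theory Defs
  imports Main
begin

text \<open>A finite simple graph: vertex set V, edges are 2-element subsets of V.\<close>
definition sgraph :: "'a set \<Rightarrow> 'a set set \<Rightarrow> bool" where
  "sgraph V E \<longleftrightarrow> finite V \<and> (\<forall>e\<in>E. \<exists>u v. u \<noteq> v \<and> u \<in> V \<and> v \<in> V \<and> e = {u, v})"

definition adj_rel :: "'a set set \<Rightarrow> ('a \<times> 'a) set" where
  "adj_rel E = {(x, y). {x, y} \<in> E}"

text \<open>Connected: nonempty, any two vertices joined by a walk along edges.\<close>
definition gconnected :: "'a set \<Rightarrow> 'a set set \<Rightarrow> bool" where
  "gconnected V E \<longleftrightarrow> V \<noteq> {} \<and> (\<forall>u\<in>V. \<forall>v\<in>V. (u, v) \<in> (adj_rel E)\<^sup>*)"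

definition induced_edges :: "'a set set \<Rightarrow> 'a set \<Rightarrow> 'a set set" where
  "induced_edges E D = {e \<in> E. e \<subseteq> D}"

definition degree :: "'a set set \<Rightarrow> 'a \<Rightarrow> nat" where
  "degree E v = card {u. {u, v} \<in> E}"

definition dominating :: "'a set \<Rightarrow> 'a set set \<Rightarrow> 'a set \<Rightarrow> bool" where
  "dominating V E D \<longleftrightarrow> D \<subseteq> V \<and> (\<forall>v \<in> V - D. \<exists>u\<in>D. {u, v} \<in> E)"

definition three_way_dominating :: "'a set \<Rightarrow> 'a set set \<Rightarrow> 'a set \<Rightarrow> bool" where
  "three_way_dominating V E D \<longleftrightarrow> dominating V E D \<and> (\<forall>v \<in> V - D. degree E v \<ge> 3)"

definition connected_three_way_dominating :: "'a set \<Rightarrow> 'a set set \<Rightarrow> 'a set \<Rightarrow> bool" where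
  "connected_three_way_dominating V E D \<longleftrightarrow>
     three_way_dominating V E D \<and> gconnected D (induced_edges E D)"

text \<open>A tree: connected and acyclic, acyclicity expressed as every edge being a bridge.\<close>
definition is_tree :: "'a set \<Rightarrow> 'a set set \<Rightarrow> bool" where
  "is_tree TV TE \<longleftrightarrow> (\<forall>e\<in>TE. e \<subseteq> TV) \<and> gconnected TV TE \<and>
     (\<forall>e\<in>TE. \<not> gconnected TV (TE - {e}))"

text \<open>No two adjacent edges (sharing an end vertex) have the same colour.\<close>
definition proper_edges :: "('a set \<Rightarrow> nat) \<Rightarrow> 'a set set \<Rightarrow> bool" where
  "proper_edges c TE \<longleftrightarrow> (\<forall>e\<in>TE. \<forall>f\<in>TE. e \<noteq> f \<and> e \<inter> f \<noteq> {} \<longrightarrow> c e \<noteq> c f)"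

text \<open>There is a proper S-tree in the graph (V,E) under colouring c.\<close>
definition has_proper_S_tree :: "'a set \<Rightarrow> 'a set set \<Rightarrow> ('a set \<Rightarrow> nat) \<Rightarrow> 'a set \<Rightarrow> bool" where
  "has_proper_S_tree V E c S \<longleftrightarrow>
     (\<exists>TV TE. TV \<subseteq> V \<and> TE \<subseteq> E \<and> is_tree TV TE \<and> S \<subseteq> TV \<and> proper_edges c TE)"

text \<open>3-proper colouring; for graphs with fewer than 3 vertices, any vertex set
  must lie in a proper tree (convention from the paper).\<close>
definition three_proper :: "'a set \<Rightarrow> 'a set set \<Rightarrow> ('a set \<Rightarrow> nat) \<Rightarrow> bool" where
  "three_proper V E c \<longleftrightarrow>
     (if card V \<ge> 3 then (\<forall>S. S \<subseteq> V \<and> card S = 3 \<longrightarrow> has_proper_S_tree V E c S)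
      else (\<forall>S. S \<subseteq> V \<longrightarrow> has_proper_S_tree V E c S))"

text \<open>Minimum number of colours: colourings use colours from {0..<k}.\<close>
definition px3 :: "'a set \<Rightarrow> 'a set set \<Rightarrow> nat" where
  "px3 V E = (LEAST k. \<exists>c. c ` E \<subseteq> {..<k} \<and> three_proper V E c)"

text \<open>The tightness example: cliques K_{i_1},...,K_{i_p} glued at v0 = (0,0).
  Clique j (1 \<le> j \<le> p) has vertices v0 and (j,t) for 1 \<le> t < i_j.\<close>
definition clique_verts :: "(nat \<Rightarrow> nat) \<Rightarrow> nat \<Rightarrow> (nat \<times> nat) set" where
  "clique_verts i j = insert (0, 0) {(j, t) | t. 1 \<le> t \<and> t < i j}"

definition glued_V :: "nat \<Rightarrow> (nat \<Rightarrow> nat) \<Rightarrow> (nat \<times> nat) set" where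
  "glued_V p i = (\<Union>j\<in>{1..p}. clique_verts i j)"

definition glued_E :: "nat \<Rightarrow> (nat \<Rightarrow> nat) \<Rightarrow> (nat \<times> nat) set set" where
  "glued_E p i = {{x, y} | x y. x \<noteq> y \<and> (\<exists>j\<in>{1..p}. x \<in> clique_verts i j \<and> y \<in> clique_verts i j)}"

end

theory Submission
  imports Defs
begin

text \<open>
  Extend an optimal colouring of \<open>G[D]\<close> by three new colours. Each vertex \<open>u\<close> outside \<open>D\<close> gets a
  new colour \<open>f u\<close>, carried by one of its edges to \<open>D\<close> (its legs), and an edge between two outer
  vertices of different colours gets the third colour. Then a path of three outer vertices with
  distinct colours, continued by a leg of its last vertex, is proper. The minimum degree 3 allows us
  to choose \<open>f\<close> such that every outer vertex with too few legs lies on such a rainbow path; choosing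
  \<open>f\<close> with as many bichromatic edges as possible prevents two vertices of the same colour from
  depending on a single neighbour. Hence any three vertices lie on disjoint branches whose legs
  have distinct colours, and these can be attached to a proper tree of \<open>G[D]\<close>.

  For cliques glued at \<open>v\<^sub>0\<close>, a tree meeting three of the cliques has three edges at \<open>v\<^sub>0\<close>.
\<close>

section \<open>Trees\<close>

lemma adj_rel_mono: "E \<subseteq> F \<Longrightarrow> adj_rel E \<subseteq> adj_rel F"
  by (auto simp: adj_rel_def)

lemma adj_rel_rtrancl_sym: "(x, y) \<in> (adj_rel E)\<^sup>* \<Longrightarrow> (y, x) \<in> (adj_rel E)\<^sup>*"
proof -
  have "sym (adj_rel E)"
    by (auto simp: sym_def adj_rel_def insert_commute)
  then show "(x, y) \<in> (adj_rel E)\<^sup>* \<Longrightarrow> (y, x) \<in> (adj_rel E)\<^sup>*"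
    using sym_rtrancl symD by metis
qed

lemma gconnected_rootI:
  assumes "r \<in> V" "\<And>v. v \<in> V \<Longrightarrow> (r, v) \<in> (adj_rel E)\<^sup>*"
  shows "gconnected V E"
  unfolding gconnected_def
  using assms adj_rel_rtrancl_sym rtrancl_trans by (metis empty_iff)

lemma is_tree_singleton: "is_tree {v} {}"
  by (auto simp: is_tree_def gconnected_def)

lemma rtrancl_leaves_set:
  assumes "(x, y) \<in> R\<^sup>*" "x \<in> A" "y \<notin> A"
  shows "\<exists>a b. (a, b) \<in> R \<and> a \<in> A \<and> b \<notin> A"
  using assms by (induction rule: rtrancl_induct) auto

text \<open>The new edge is a bridge because it is the only edge at \<open>y\<close>. An old edge
  stays a bridge because folding \<open>y\<close> onto \<open>x\<close> turns every walk avoiding it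
  into a walk of the old tree avoiding it.\<close>

lemma is_tree_insert_leaf:
  assumes t: "is_tree TV TE" and x: "x \<in> TV" and y: "y \<notin> TV"
  shows "is_tree (insert y TV) (insert {x, y} TE)"
proof -
  have sub: "\<forall>e\<in>TE. e \<subseteq> TV" and con: "gconnected TV TE"
    and br: "\<And>e. e \<in> TE \<Longrightarrow> \<not> gconnected TV (TE - {e})"
    using t by (auto simp: is_tree_def)
  have new: "{x, y} \<notin> TE" using sub y by auto
  have mono: "(adj_rel TE)\<^sup>* \<subseteq> (adj_rel (insert {x, y} TE))\<^sup>*"
    by (intro rtrancl_mono adj_rel_mono) auto
  have "gconnected (insert y TV) (insert {x, y} TE)"
  proof (rule gconnected_rootI[of x])
    fix v assume "v \<in> insert y TV"
    moreover have "(x, y) \<in> adj_rel (insert {x, y} TE)" by (simp add: adj_rel_def)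
    ultimately show "(x, v) \<in> (adj_rel (insert {x, y} TE))\<^sup>*"
      using con x mono by (auto simp: gconnected_def)
  qed (use x in simp)
  moreover have "\<not> gconnected (insert y TV) (insert {x, y} TE - {e})"
    if e: "e \<in> insert {x, y} TE" for e
  proof
    assume g: "gconnected (insert y TV) (insert {x, y} TE - {e})"
    show False
    proof (cases "e = {x, y}")
      case True
      then have "(x, y) \<in> (adj_rel TE)\<^sup>*"
        using g new x by (auto simp: gconnected_def)
      from rtrancl_leaves_set[OF this x y] show False
        using sub by (auto simp: adj_rel_def)
    next
      case False
      then have eT: "e \<in> TE" using e by auto
      let ?h = "\<lambda>z. if z = y then x else z"
      have walk_step: "(?h a, ?h b) \<in> (adj_rel (TE - {e}))\<^sup>*"
        if "(a, b) \<in> adj_rel (insert {x, y} TE - {e})" for a b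
      proof -
        from that consider "{a, b} = {x, y}" | "{a, b} \<in> TE - {e}"
          by (auto simp: adj_rel_def)
        then show ?thesis
        proof cases
          case 1 then show ?thesis by (auto simp: doubleton_eq_iff)
        next
          case 2
          then have "a \<noteq> y" "b \<noteq> y" using sub y by auto
          with 2 show ?thesis by (auto simp: adj_rel_def)
        qed
      qed
      have walk: "(?h a, ?h b) \<in> (adj_rel (TE - {e}))\<^sup>*"
        if "(a, b) \<in> (adj_rel (insert {x, y} TE - {e}))\<^sup>*" for a b
        using that
      proof (induction rule: rtrancl_induct)
        case (step b c)
        then show ?case using walk_step rtrancl_trans by metis
      qed simp
      have "gconnected TV (TE - {e})"
      proof (rule gconnected_rootI[OF x])
        fix v assume v: "v \<in> TV"
        then have "(x, v) \<in> (adj_rel (insert {x, y} TE - {e}))\<^sup>*"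
          using g x by (auto simp: gconnected_def)
        from walk[OF this] show "(x, v) \<in> (adj_rel (TE - {e}))\<^sup>*"
          using v x y by (auto split: if_splits)
      qed
      then show False using br eT by blast
    qed
  qed
  ultimately show ?thesis using sub x unfolding is_tree_def by blast
qed

lemma proper_edges_insert_leaf:
  assumes "proper_edges c TE" "\<forall>e\<in>TE. y \<notin> e" "\<And>e. e \<in> TE \<Longrightarrow> x \<in> e \<Longrightarrow> c e \<noteq> c {x, y}"
  shows "proper_edges c (insert {x, y} TE)"
  unfolding proper_edges_def
proof (intro ballI impI)
  fix e g
  assume "e \<in> insert {x, y} TE" "g \<in> insert {x, y} TE" "e \<noteq> g \<and> e \<inter> g \<noteq> {}"
  then consider "e \<in> TE" "g \<in> TE" "e \<noteq> g \<and> e \<inter> g \<noteq> {}"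
    | "e = {x, y}" "g \<in> TE" "x \<in> g" | "g = {x, y}" "e \<in> TE" "x \<in> e"
    using assms(2) by auto
  then show "c e \<noteq> c g"
    using assms(1,3) unfolding proper_edges_def by cases metis+
qed

section \<open>Spanning trees and attainment of the minimum in \<open>px3\<close>\<close>

lemma sgraph_edgeD:
  assumes "sgraph V E" "{x, y} \<in> E"
  shows "x \<noteq> y" "x \<in> V" "y \<in> V"
  using assms unfolding sgraph_def by (metis doubleton_eq_iff insert_absorb2)+

lemma sgraph_finite_edges: "sgraph V E \<Longrightarrow> finite E"
  by (rule finite_subset[of _ "Pow V"]) (auto simp: sgraph_def)

text \<open>A subtree with the most vertices spans: a walk to a missing vertex leaves it along an
  edge whose far end could be attached as a leaf.\<close>

lemma spanning_tree_exists:
  assumes G: "sgraph V E" and con: "gconnected V E"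
  shows "\<exists>TE\<subseteq>E. is_tree V TE"
proof -
  have fin: "finite V" using G by (simp add: sgraph_def)
  obtain r where r: "r \<in> V" using con by (auto simp: gconnected_def)
  let ?P = "\<lambda>TV. TV \<subseteq> V \<and> (\<exists>TE\<subseteq>E. is_tree TV TE)"
  have P0: "?P {r}" using r is_tree_singleton[of r] by blast
  have bound: "\<forall>TV. ?P TV \<longrightarrow> card TV < Suc (card V)"
    using fin card_mono by (metis less_Suc_eq_le)
  obtain TV where TV: "?P TV" and max: "\<forall>W. ?P W \<longrightarrow> card W \<le> card TV"
    using ex_has_greatest_nat[of ?P "{r}" card, OF P0 bound] by auto
  then obtain TE where TE: "TE \<subseteq> E" "is_tree TV TE" by blast
  obtain x where x: "x \<in> TV" using TE by (auto simp: is_tree_def gconnected_def)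
  have "V \<subseteq> TV"
  proof (rule ccontr)
    assume "\<not> V \<subseteq> TV"
    then obtain v where v: "v \<in> V" "v \<notin> TV" by blast
    then have "(x, v) \<in> (adj_rel E)\<^sup>*" using con x TV by (auto simp: gconnected_def)
    from rtrancl_leaves_set[OF this x v(2)]
    obtain a b where ab: "{a, b} \<in> E" "a \<in> TV" "b \<notin> TV" by (auto simp: adj_rel_def)
    have "?P (insert b TV)"
      using is_tree_insert_leaf[OF TE(2) ab(2,3)] ab TE(1) TV sgraph_edgeD(3)[OF G ab(1)]
      by (meson insert_subset)
    then have "card (insert b TV) \<le> card TV" using max by blast
    then show False using ab TV fin finite_subset by fastforce
  qed
  then have "TV = V" using TV by blast
  then show ?thesis using TE by auto
qed

text \<open>Since \<open>px3\<close> is a \<open>LEAST\<close>, some admissible colouring has to be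
  exhibited: with all edges coloured differently, a spanning tree is proper.\<close>

lemma px3_attained:
  assumes G: "sgraph V E" and con: "gconnected V E"
  shows "\<exists>c. c ` E \<subseteq> {..<px3 V E} \<and> three_proper V E c"
proof -
  obtain c and n :: nat where c: "c ` E = {..<n}" "inj_on c E"
    using finite_imp_inj_to_nat_seg[OF sgraph_finite_edges[OF G]]
    by (metis lessThan_def)
  obtain TE where TE: "TE \<subseteq> E" "is_tree V TE"
    using spanning_tree_exists[OF G con] by blast
  have "proper_edges c TE"
    using c(2) TE(1) unfolding proper_edges_def inj_on_def by blast
  then have "has_proper_S_tree V E c S" if "S \<subseteq> V" for S
    using that TE unfolding has_proper_S_tree_def by blast
  then have "three_proper V E c" by (simp add: three_proper_def)
  then have "\<exists>k. \<exists>c. c ` E \<subseteq> {..<k} \<and> three_proper V E c" using c by blast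
  from LeastI_ex[OF this] show ?thesis unfolding px3_def .
qed

lemma px3_le: "c ` E \<subseteq> {..<k} \<Longrightarrow> three_proper V E c \<Longrightarrow> px3 V E \<le> k"
  unfolding px3_def by (rule Least_le) blast

text \<open>Repetitions among \<open>x\<close>, \<open>y\<close>, \<open>z\<close> are allowed,
  because the roots of branches may coincide: the set is enlarged to three vertices, or the
  convention for small graphs applies.\<close>

lemma three_proper_triple:
  assumes "finite V" "three_proper V E c" "x \<in> V" "y \<in> V" "z \<in> V"
  shows "has_proper_S_tree V E c {x, y, z}"
proof (cases "card V \<ge> 3")
  case True
  have "card {x, y, z} \<le> 3" by (simp add: card_insert_if)
  then obtain S where S: "{x, y, z} \<subseteq> S" "S \<subseteq> V" "card S = 3"
    using exists_subset_between[of "{x, y, z}" 3 V] assms True by auto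
  then have "has_proper_S_tree V E c S"
    using assms(2) True unfolding three_proper_def by auto
  then show ?thesis using S(1) unfolding has_proper_S_tree_def by blast
next
  case False
  then show ?thesis using assms unfolding three_proper_def by auto
qed

section \<open>Colouring the legs\<close>

text \<open>For \<open>a \<noteq> b\<close> below 3 this is the remaining colour, as 0 + 1 + 2 = 3;
  \<open>mod 3\<close> keeps the value below 3 also for \<open>a = b = 0\<close>.\<close>

definition third :: "nat \<Rightarrow> nat \<Rightarrow> nat" where
  "third a b = (3 - (a + b)) mod 3"

lemma third_less: "third a b < 3"
  by (simp add: third_def)

lemma less_3_cases: "a < (3::nat) \<longleftrightarrow> a = 0 \<or> a = 1 \<or> a = 2"
  by auto

lemma third_eq_iff:
  assumes "a < 3" "b < 3" "c < 3" "a \<noteq> b"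
  shows "third a b = c \<longleftrightarrow> c \<noteq> a \<and> c \<noteq> b"
  using assms by (auto simp: less_3_cases third_def)

definition rainbow_path :: "'a set \<Rightarrow> ('a \<Rightarrow> 'a \<Rightarrow> bool) \<Rightarrow> ('a \<Rightarrow> nat) \<Rightarrow> 'a \<Rightarrow> 'a \<Rightarrow> 'a \<Rightarrow> bool" where
  "rainbow_path U adj f x y z \<longleftrightarrow> x \<in> U \<and> y \<in> U \<and> z \<in> U \<and> adj x y \<and> adj y z \<and>
     f x \<noteq> f y \<and> f y \<noteq> f z \<and> f x \<noteq> f z"

text \<open>\<open>m v\<close> stands for the number of legs of \<open>v\<close>. With three legs
  all colours can appear at \<open>v\<close> itself; with two, a neighbour of another colour
  supplies the missing one; otherwise \<open>v\<close> relies on a rainbow path.\<close>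

definition served :: "'a set \<Rightarrow> ('a \<Rightarrow> 'a \<Rightarrow> bool) \<Rightarrow> ('a \<Rightarrow> nat) \<Rightarrow> ('a \<Rightarrow> nat) \<Rightarrow> 'a \<Rightarrow> bool" where
  "served U adj m f v \<longleftrightarrow> m v \<ge> 3 \<or> (m v \<ge> 2 \<and> (\<exists>x\<in>U. adj v x \<and> f x \<noteq> f v)) \<or>
     (\<exists>x y z. rainbow_path U adj f x y z \<and> v \<in> {x, y, z})"

lemma rainbow_path_mono:
  assumes "rainbow_path U adj f x y z" "U \<subseteq> W" "\<And>v. v \<in> U \<Longrightarrow> g v = f v"
  shows "rainbow_path W adj g x y z"
  using assms by (auto simp: rainbow_path_def)

text \<open>An abstraction of the outer vertices: the last two assumptions are what minimum degree 3
  leaves for a vertex with at most one or at most two legs.\<close>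

locale leg_demand =
  fixes U :: "'a set" and adj :: "'a \<Rightarrow> 'a \<Rightarrow> bool" and m :: "'a \<Rightarrow> nat"
  assumes fin: "finite U"
    and sym: "adj x y \<Longrightarrow> adj y x"
    and irr: "\<not> adj x x"
    and two_nbrs: "v \<in> U \<Longrightarrow> m v \<le> 1 \<Longrightarrow> \<exists>x\<in>U. \<exists>y\<in>U. x \<noteq> y \<and> adj v x \<and> adj v y"
    and one_nbr: "v \<in> U \<Longrightarrow> m v \<le> 2 \<Longrightarrow> \<exists>x\<in>U. adj v x"
begin

text \<open>The extra demand on neighbours of a different colour makes a partial colouring extendable to
  any vertex adjacent to its domain: the new vertex completes a rainbow path.\<close>

definition partial_serving :: "'a set \<Rightarrow> ('a \<Rightarrow> nat) \<Rightarrow> bool" where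
  "partial_serving W f \<longleftrightarrow> W \<subseteq> U \<and> (\<forall>v. f v < 3) \<and> (\<forall>v\<in>W. \<exists>x\<in>W. adj v x \<and> f x \<noteq> f v) \<and>
     (\<forall>v\<in>W. m v \<ge> 2 \<or> (\<exists>x y z. rainbow_path W adj f x y z \<and> v \<in> {x, y, z}))"

lemma partial_serving_extend:
  assumes W: "partial_serving W f" and X: "X \<subseteq> U" and g3: "\<forall>v. g v < 3"
    and eq: "\<And>v. v \<in> W \<Longrightarrow> g v = f v"
    and nb: "\<And>v. v \<in> X - W \<Longrightarrow> \<exists>x\<in>W \<union> X. adj v x \<and> g x \<noteq> g v"
    and rp: "\<And>v. v \<in> X - W \<Longrightarrow> m v \<ge> 2 \<or> (\<exists>x y z. rainbow_path (W \<union> X) adj g x y z \<and> v \<in> {x, y, z})"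
  shows "partial_serving (W \<union> X) g"
proof -
  have "\<exists>x\<in>W \<union> X. adj v x \<and> g x \<noteq> g v" if "v \<in> W \<union> X" for v
  proof (cases "v \<in> W")
    case True
    then obtain x where "x \<in> W" "adj v x" "f x \<noteq> f v"
      using W unfolding partial_serving_def by blast
    then show ?thesis using eq True by auto
  qed (use nb that in blast)
  moreover have "m v \<ge> 2 \<or> (\<exists>x y z. rainbow_path (W \<union> X) adj g x y z \<and> v \<in> {x, y, z})"
    if "v \<in> W \<union> X" for v
  proof (cases "v \<in> W")
    case True
    then have "m v \<ge> 2 \<or> (\<exists>x y z. rainbow_path W adj f x y z \<and> v \<in> {x, y, z})"
      using W unfolding partial_serving_def by blast
    then show ?thesis
      using rainbow_path_mono[of W adj f _ _ _ "W \<union> X" g] eq by blast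
  qed (use rp that in blast)
  ultimately show ?thesis using W X g3 unfolding partial_serving_def by blast
qed

text \<open>A partial serving on a largest set \<open>W\<close> is closed under adjacency, and every
  vertex outside \<open>W\<close> has three legs: otherwise a path with colours 0, 1, 2 or an edge
  with colours 0, 1 could be added.\<close>

lemma serving_exists: "\<exists>f. (\<forall>v. f v < 3) \<and> (\<forall>v\<in>U. served U adj m f v)"
proof -
  let ?P = "\<lambda>W. \<exists>f. partial_serving W f"
  have "?P {}" unfolding partial_serving_def by (auto intro: exI[of _ "\<lambda>_. 0"])
  moreover have "\<forall>W. ?P W \<longrightarrow> card W < Suc (card U)"
    using fin card_mono unfolding partial_serving_def by (metis less_Suc_eq_le)
  ultimately obtain W where PW: "?P W" and max: "\<forall>W'. ?P W' \<longrightarrow> card W' \<le> card W"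
    using ex_has_greatest_nat[of ?P "{}" card] by blast
  then obtain f where f: "partial_serving W f" by blast
  have WU: "W \<subseteq> U" and f3: "\<And>v. f v < 3" using f by (auto simp: partial_serving_def)
  have noext: "X \<subseteq> W" if "partial_serving (W \<union> X) g" for X g
  proof -
    have "card (W \<union> X) \<le> card W" using max that by blast
    moreover have "finite (W \<union> X)" using that fin finite_subset unfolding partial_serving_def by blast
    ultimately have "W = W \<union> X" by (metis Un_upper1 card_seteq)
    then show ?thesis by blast
  qed
  have closed: "u \<in> W" if u: "u \<in> U" and x: "x \<in> W" "adj u x" for u x
  proof (rule ccontr)
    assume nu: "u \<notin> W"
    obtain y where y: "y \<in> W" "adj x y" "f y \<noteq> f x"
      using f x unfolding partial_serving_def by blast
    let ?g = "f(u := third (f x) (f y))"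
    have d: "third (f x) (f y) \<noteq> f x" "third (f x) (f y) \<noteq> f y"
      using third_eq_iff[of "f x" "f y" "third (f x) (f y)"] f3 y(3) third_less by auto
    have rp: "rainbow_path (W \<union> {u}) adj ?g u x y"
      using nu x y d by (auto simp: rainbow_path_def)
    have "partial_serving (W \<union> {u}) ?g"
    proof (rule partial_serving_extend[OF f])
      fix v assume "v \<in> {u} - W"
      then show "\<exists>x\<in>W \<union> {u}. adj v x \<and> ?g x \<noteq> ?g v" using x d nu by auto
      show "m v \<ge> 2 \<or> (\<exists>x y z. rainbow_path (W \<union> {u}) adj ?g x y z \<and> v \<in> {x, y, z})"
        using rp \<open>v \<in> {u} - W\<close> by blast
    qed (use u nu f3 third_less in auto)
    then show False using noext nu by blast
  qed
  have rest: "m u \<ge> 3" if u: "u \<in> U" "u \<notin> W" for u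
  proof (rule ccontr)
    assume "\<not> 3 \<le> m u"
    then have mu: "m u \<le> 2" by simp
    obtain x where x: "x \<in> U" "adj u x" using one_nbr[OF u(1) mu] by blast
    have xW: "x \<notin> W" using closed u x by blast
    have xu: "x \<noteq> u" using x irr by blast
    \<comment> \<open>A vertex with at most one leg has two neighbours, both outside
      \<open>W\<close> by \<open>closed\<close>; it becomes the middle of a new rainbow
      path.\<close>
    have ge2: "m v \<ge> 2" if v: "v \<in> U" "v \<notin> W" for v
    proof (rule ccontr)
      assume "\<not> 2 \<le> m v"
      then obtain a b where ab: "a \<in> U" "b \<in> U" "a \<noteq> b" "adj v a" "adj v b"
        using two_nbrs[OF v(1)] by auto
      have n: "a \<notin> W" "b \<notin> W" "a \<noteq> v" "b \<noteq> v" using closed v ab irr by blast+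
      let ?g = "f(a := 0, v := 1, b := 2)"
      have rp: "rainbow_path (W \<union> {a, v, b}) adj ?g a v b"
        using ab n v sym by (auto simp: rainbow_path_def)
      have "partial_serving (W \<union> {a, v, b}) ?g"
      proof (rule partial_serving_extend[OF f])
        fix w assume "w \<in> {a, v, b} - W"
        then show "\<exists>x\<in>W \<union> {a, v, b}. adj w x \<and> ?g x \<noteq> ?g w" using ab n sym by auto
      qed (use ab v n f3 rp in auto)
      then show False using noext v by blast
    qed
    let ?g = "f(u := 0, x := 1)"
    have "partial_serving (W \<union> {u, x}) ?g"
    proof (rule partial_serving_extend[OF f])
      fix w assume "w \<in> {u, x} - W"
      then show "\<exists>z\<in>W \<union> {u, x}. adj w z \<and> ?g z \<noteq> ?g w" using x xu sym by auto
    qed (use u x xW f3 ge2 in auto)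
    then show False using noext u by blast
  qed
  have "served U adj m f v" if v: "v \<in> U" for v
  proof (cases "v \<in> W")
    case True
    then show ?thesis
      using f WU rainbow_path_mono[of W adj f _ _ _ U f]
      unfolding partial_serving_def served_def by blast
  next
    case False
    then show ?thesis using rest v by (simp add: served_def)
  qed
  then show ?thesis using f3 by blast
qed

text \<open>Among all serving colourings take one with the maximal number of bichromatic edges: a vertex
  \<open>u\<close> violating the last claim could be given the third colour, since \<open>v\<close> replaces it in every
  rainbow path through \<open>x\<close>.\<close>

lemma serving_separating_exists:
  "\<exists>f. (\<forall>v. f v < 3) \<and> (\<forall>v\<in>U. served U adj m f v) \<and>
     (\<forall>u\<in>U. \<forall>v\<in>U. \<forall>x\<in>U. u \<noteq> v \<and> f u = f v \<and> adj u x \<and> adj v x \<and> f x \<noteq> f u \<and> m u \<le> 1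
        \<longrightarrow> (\<exists>z\<in>U. z \<noteq> x \<and> adj u z \<and> f z \<noteq> f u))"
proof -
  let ?P = "\<lambda>f :: 'a \<Rightarrow> nat. (\<forall>v. f v < 3) \<and> (\<forall>v\<in>U. served U adj m f v)"
  let ?B = "\<lambda>f :: 'a \<Rightarrow> nat. {(a, b). a \<in> U \<and> b \<in> U \<and> adj a b \<and> f a \<noteq> f b}"
  have sub: "?B f \<subseteq> U \<times> U" for f by auto
  then have finB: "finite (?B f)" for f using fin by (meson finite_SigmaI finite_subset)
  have "\<forall>f. ?P f \<longrightarrow> card (?B f) < Suc (card (U \<times> U))"
    using card_mono[OF _ sub] fin by (simp add: less_Suc_eq_le)
  then obtain f where f: "?P f" and max: "\<forall>g. ?P g \<longrightarrow> card (?B g) \<le> card (?B f)"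
    using serving_exists ex_has_greatest_nat[of ?P _ "\<lambda>f. card (?B f)"] by blast
  have "\<exists>z\<in>U. z \<noteq> x \<and> adj u z \<and> f z \<noteq> f u"
    if U: "u \<in> U" "v \<in> U" "x \<in> U" and uv: "u \<noteq> v" "f u = f v" and ux: "adj u x" and vx: "adj v x"
      and fx: "f x \<noteq> f u" and mu: "m u \<le> 1" for u v x
  proof (rule ccontr)
    assume "\<not> ?thesis"
    then have only: "\<And>z. z \<in> U \<Longrightarrow> adj u z \<Longrightarrow> z \<noteq> x \<Longrightarrow> f z = f u" by blast
    obtain z where z: "z \<in> U" "adj u z" "z \<noteq> x" using two_nbrs[OF U(1) mu] by metis
    have fz: "f z = f u" using only z by blast
    have ne: "z \<noteq> u" "x \<noteq> u" using z ux irr by blast+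
    define t where "t = third (f u) (f x)"
    have t: "t < 3" "t \<noteq> f u" "t \<noteq> f x"
      using third_eq_iff[of "f u" "f x" t] f fx third_less by (auto simp: t_def)
    let ?g = "f(u := t)"
    \<comment> \<open>The recoloured \<open>u\<close> is the middle of a rainbow path, since
      \<open>z\<close> keeps the old colour of \<open>u\<close>.\<close>
    have zux: "rainbow_path U adj ?g z u x"
      using z U ux fz ne t fx sym by (auto simp: rainbow_path_def)
    have "served U adj m ?g q" if q: "q \<in> U" for q
    proof (cases "q = u \<or> q = x \<or> m q \<ge> 3")
      case True
      then show ?thesis using zux unfolding served_def by blast
    next
      case nq: False
      have "served U adj m f q" using f q by blast
      then consider (two) y where "m q \<ge> 2" "y \<in> U" "adj q y" "f y \<noteq> f q"
        | (path) a b c where "rainbow_path U adj f a b c" "q \<in> {a, b, c}"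
        using nq unfolding served_def by blast
      then show ?thesis
      proof cases
        case two
        have "?g y \<noteq> ?g q"
        \<comment> \<open>If the neighbour is \<open>u\<close>, then \<open>q \<noteq> x\<close> has
          the old colour of \<open>u\<close>, and the new colour differs from it.\<close>
        proof (cases "y = u")
          case True
          then have "f q = f u" using only[of q] sym two q nq by blast
          then show ?thesis using nq True t by auto
        qed (use nq two in auto)
        then show ?thesis using two unfolding served_def by blast
      next
        case path
        then have p: "a \<in> U" "b \<in> U" "c \<in> U" "adj a b" "adj b c" "f a \<noteq> f b" "f b \<noteq> f c" "f a \<noteq> f c"
          by (auto simp: rainbow_path_def)
        \<comment> \<open>A middle vertex has two neighbours of colours other than its own, while
          \<open>u\<close> has only \<open>x\<close>.\<close>
        have bu: "b \<noteq> u"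
        proof
          assume "b = u"
          then have "a = x" "c = x" using only[of a] only[of c] p sym by metis+
          then show False using p by simp
        qed
        \<comment> \<open>As an end of the path, \<open>u\<close> is next to \<open>x\<close>, and
          \<open>v\<close>, which keeps the old colour of \<open>u\<close>, takes its place.\<close>
        consider "a = u" | "c = u" | "a \<noteq> u" "c \<noteq> u" by blast
        then show ?thesis
        proof cases
          case 1
          then have bx: "b = x" using only[of b] p by metis
          then have "rainbow_path U adj ?g v x c"
            using p U 1 uv vx ne by (auto simp: rainbow_path_def)
          then show ?thesis using path(2) 1 nq bx unfolding served_def by blast
        next
          case 2
          then have bx: "b = x" using only[of b] p sym by metis
          then have "rainbow_path U adj ?g a x v"
            using p U 2 uv vx ne sym by (auto simp: rainbow_path_def)
          then show ?thesis using path(2) 2 nq bx unfolding served_def by blast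
        next
          case 3
          then have "rainbow_path U adj ?g a b c"
            using p bu by (auto simp: rainbow_path_def)
          then show ?thesis using path(2) unfolding served_def by blast
        qed
      qed
    qed
    then have "?P ?g" using f t by auto
    then have le: "card (?B ?g) \<le> card (?B f)" using max by blast
    \<comment> \<open>No bichromatic edge is lost, since the only one at \<open>u\<close> led to
      \<open>x\<close> and \<open>t \<noteq> f x\<close>; the edge from \<open>u\<close> to
      \<open>z\<close> is gained, which contradicts maximality.\<close>
    have "?B f \<subseteq> ?B ?g"
    proof (rule subrelI)
      fix a b assume "(a, b) \<in> ?B f"
      then have ab: "a \<in> U" "b \<in> U" "adj a b" "f a \<noteq> f b" by auto
      then have "?g a \<noteq> ?g b"
        using only[of a] only[of b] sym[OF ab(3)] t by (cases "a = u"; cases "b = u") auto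
      then show "(a, b) \<in> ?B ?g" using ab by simp
    qed
    moreover have "(u, z) \<in> ?B ?g" "(u, z) \<notin> ?B f" using U z fz ne t by auto
    ultimately have "?B f \<subset> ?B ?g" by blast
    then show False using psubset_card_mono[OF finB] le by (meson leD)
  qed
  then show ?thesis using f by blast
qed

end

section \<open>Growing a proper tree out of the dominating set\<close>

text \<open>\<open>c\<close> colours the edges inside \<open>D\<close> with colours below
  \<open>k\<close>; \<open>l u d\<close> is the new colour of the leg from \<open>u\<close> to
  \<open>d\<close>. In \<open>cases\<close>, the last two alternatives make \<open>u\<close> the
  middle or an end of a rainbow path. \<open>separation\<close> gives \<open>u\<close> a way out
  besides \<open>x\<close> when \<open>v\<close>, of the same colour, shares the neighbour
  \<open>x\<close>.\<close>

locale leg_colouring =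
  fixes V :: "'a set" and E :: "'a set set" and D :: "'a set"
    and c :: "'a set \<Rightarrow> nat" and k :: nat and f :: "'a \<Rightarrow> nat" and l :: "'a \<Rightarrow> 'a \<Rightarrow> nat"
  assumes graph: "sgraph V E"
    and DV: "D \<subseteq> V"
    and c_less: "e \<in> induced_edges E D \<Longrightarrow> c e < k"
    and core_trees: "r \<in> D \<Longrightarrow> s \<in> D \<Longrightarrow> t \<in> D \<Longrightarrow> has_proper_S_tree D (induced_edges E D) c {r, s, t}"
    and f3: "f v < 3"
    and l3: "l u d < 3"
    and primary: "u \<in> V - D \<Longrightarrow> \<exists>d\<in>D. {u, d} \<in> E \<and> l u d = f u"
    and cases: "u \<in> V - D \<Longrightarrow>
      (\<forall>b<3. \<exists>d\<in>D. {u, d} \<in> E \<and> l u d = b) \<or>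
      (\<exists>d\<in>D. \<exists>x\<in>V - D. {u, d} \<in> E \<and> {u, x} \<in> E \<and> f x \<noteq> f u \<and> l u d \<noteq> f u \<and> l u d \<noteq> f x) \<or>
      (\<exists>x\<in>V - D. \<exists>y\<in>V - D. {u, x} \<in> E \<and> {u, y} \<in> E \<and> f u \<noteq> f x \<and> f u \<noteq> f y \<and> f x \<noteq> f y) \<or>
      (\<exists>x\<in>V - D. \<exists>y\<in>V - D. {u, x} \<in> E \<and> {x, y} \<in> E \<and> f u \<noteq> f x \<and> f u \<noteq> f y \<and> f x \<noteq> f y)"
    and separation: "u \<in> V - D \<Longrightarrow> v \<in> V - D \<Longrightarrow> x \<in> V - D \<Longrightarrow> u \<noteq> v \<Longrightarrow> f u = f v \<Longrightarrow>
      {u, x} \<in> E \<Longrightarrow> {v, x} \<in> E \<Longrightarrow> f x \<noteq> f u \<Longrightarrow>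
      (\<exists>z\<in>V - D. z \<noteq> x \<and> {u, z} \<in> E \<and> f z \<noteq> f u) \<or> (\<exists>d\<in>D. {u, d} \<in> E \<and> l u d \<noteq> f u \<and> l u d \<noteq> f x)"
begin

text \<open>Colours from \<open>k\<close> on are new. The second case is \<open>third\<close> of the
  colours of the two ends, written as a function of the edge; \<open>the_elem\<close> extracts the
  outer and the inner end of a leg.\<close>

definition ext :: "'a set \<Rightarrow> nat" where
  "ext e = (if e \<subseteq> D then c e
            else if e \<inter> D = {} then k + (3 - sum f e) mod 3
            else k + l (the_elem (e - D)) (the_elem (e \<inter> D)))"

lemma ext_leg: "u \<notin> D \<Longrightarrow> d \<in> D \<Longrightarrow> ext {u, d} = k + l u d"
proof -
  assume a: "u \<notin> D" "d \<in> D"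
  then have "{u, d} - D = {u}" "{u, d} \<inter> D = {d}" by auto
  then show ?thesis using a by (simp add: ext_def)
qed

lemma ext_outer: "u \<notin> D \<Longrightarrow> v \<notin> D \<Longrightarrow> u \<noteq> v \<Longrightarrow> ext {u, v} = k + third (f u) (f v)"
  by (simp add: ext_def third_def)

lemma ext_range: "ext ` E \<subseteq> {..<k + 3}"
proof -
  have "ext e < k + 3" if "e \<in> E" for e
    using c_less[of e] that l3 by (auto simp: ext_def induced_edges_def)
  then show ?thesis by auto
qed

text \<open>\<open>A\<close> records the new colours already used on legs. Edges inside
  \<open>D\<close> have colours below \<open>k\<close>, so a leg with a new colour outside
  \<open>A\<close> fits at any vertex of \<open>D\<close> in the tree.\<close>

definition growth :: "nat set \<Rightarrow> 'a set \<Rightarrow> 'a set set \<Rightarrow> bool" where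
  "growth A TV TE \<longleftrightarrow> TV \<subseteq> V \<and> TE \<subseteq> E \<and> is_tree TV TE \<and> proper_edges ext TE \<and>
     (\<forall>e\<in>TE. e \<inter> D \<noteq> {} \<longrightarrow> ext e < k \<or> ext e \<in> (+) k ` A)"

definition grown :: "nat set \<Rightarrow> 'a set \<Rightarrow> bool" where
  "grown A TV \<longleftrightarrow> (\<exists>TE. growth A TV TE)"

text \<open>All tree edges at the tip \<open>t\<close> have colour \<open>k + a\<close>, so the
  branch can be prolonged there by an outer edge of any other colour.\<close>

definition tipped :: "nat set \<Rightarrow> 'a set \<Rightarrow> 'a \<Rightarrow> nat \<Rightarrow> bool" where
  "tipped A TV t a \<longleftrightarrow> t \<in> TV \<and> t \<notin> D \<and>
     (\<exists>TE. growth A TV TE \<and> (\<forall>e\<in>TE. t \<in> e \<longrightarrow> ext e = k + a))"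

lemma tipped_imp_grown: "tipped A TV t a \<Longrightarrow> grown A TV"
  unfolding tipped_def grown_def by blast

lemma grown_mono: "grown A TV \<Longrightarrow> A \<subseteq> B \<Longrightarrow> grown B TV"
  unfolding grown_def growth_def by (meson image_mono subsetD)

lemma growth_insert_leaf:
  assumes g: "growth A TV TE" and x: "x \<in> TV" and u: "u \<in> V" "u \<notin> TV" "{x, u} \<in> E"
    and col: "\<And>e. e \<in> TE \<Longrightarrow> x \<in> e \<Longrightarrow> ext e \<noteq> ext {x, u}"
    and AB: "A \<subseteq> B" "{x, u} \<inter> D \<noteq> {} \<Longrightarrow> ext {x, u} \<in> (+) k ` B"
  shows "growth B (insert u TV) (insert {x, u} TE)"
proof -
  have T: "TV \<subseteq> V" "TE \<subseteq> E" "is_tree TV TE" "proper_edges ext TE"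
    and old: "\<And>e. e \<in> TE \<Longrightarrow> e \<inter> D \<noteq> {} \<Longrightarrow> ext e < k \<or> ext e \<in> (+) k ` A"
    using g by (simp_all add: growth_def)
  have un: "\<forall>e\<in>TE. u \<notin> e" using T(3) u(2) unfolding is_tree_def by blast
  have p: "proper_edges ext (insert {x, u} TE)"
    using proper_edges_insert_leaf[OF T(4) un col] .
  have "ext e < k \<or> ext e \<in> (+) k ` B" if "e \<in> insert {x, u} TE" "e \<inter> D \<noteq> {}" for e
  proof (cases "e = {x, u}")
    case True
    then show ?thesis using AB(2) that by simp
  next
    case False
    then show ?thesis using old[of e] that image_mono[OF AB(1), of "(+) k"] by blast
  qed
  then show ?thesis
    using p is_tree_insert_leaf[OF T(3) x u(2)] T(1,2) u unfolding growth_def by simp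
qed

lemma growth_avoids: "growth A TV TE \<Longrightarrow> u \<notin> TV \<Longrightarrow> e \<in> TE \<Longrightarrow> u \<notin> e"
  unfolding growth_def is_tree_def by blast

lemma tipped_leg:
  assumes g: "grown A TV" and d: "d \<in> D" "d \<in> TV" and u: "u \<in> V - D" "u \<notin> TV" "{u, d} \<in> E"
    and a: "l u d \<notin> A"
  shows "tipped (insert (l u d) A) (insert u TV) u (l u d)"
proof -
  obtain TE where TE: "growth A TV TE" using g unfolding grown_def by blast
  have new: "ext {d, u} = k + l u d" using ext_leg[of u d] u d by (simp add: insert_commute)
  have "growth (insert (l u d) A) (insert u TV) (insert {d, u} TE)"
  proof (rule growth_insert_leaf[OF TE d(2)])
    fix e assume "e \<in> TE" "d \<in> e"
    then have "ext e < k \<or> ext e \<in> (+) k ` A" using TE d unfolding growth_def by blast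
    then show "ext e \<noteq> ext {d, u}" using new a by auto
  qed (use u new in \<open>auto simp: insert_commute\<close>)
  then show ?thesis
    unfolding tipped_def using u new growth_avoids[OF TE u(2)] by auto
qed

lemma tipped_step:
  assumes t: "tipped A TV t a" and v: "v \<in> V - D" "v \<notin> TV" "{v, t} \<in> E"
    and a: "third (f v) (f t) \<noteq> a"
  shows "tipped A (insert v TV) v (third (f v) (f t))"
proof -
  obtain TE where TE: "growth A TV TE" and tV: "t \<in> TV" "t \<notin> D"
    and tip: "\<And>e. e \<in> TE \<Longrightarrow> t \<in> e \<Longrightarrow> ext e = k + a"
    using t unfolding tipped_def by blast
  have "v \<noteq> t" using v tV by blast
  then have new: "ext {t, v} = k + third (f v) (f t)"
    using ext_outer[of v t] v tV by (simp add: insert_commute)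
  have "growth A (insert v TV) (insert {t, v} TE)"
    by (rule growth_insert_leaf[OF TE tV(1)]) (use v tV tip new a in \<open>auto simp: insert_commute\<close>)
  then show ?thesis
    unfolding tipped_def using v new growth_avoids[OF TE v(2)] by auto
qed

text \<open>Quantifying over all grown trees makes branches composable: adding \<open>X\<close> uses
  up only the leg colour \<open>a\<close>. An empty \<open>X\<close> is allowed and serves the
  vertices of \<open>D\<close>.\<close>

definition branch :: "nat \<Rightarrow> 'a \<Rightarrow> 'a set \<Rightarrow> bool" where
  "branch a r X \<longleftrightarrow> r \<in> D \<and> X \<subseteq> V - D \<and>
     (\<forall>A TV. grown A TV \<and> a \<notin> A \<and> r \<in> TV \<and> X \<inter> TV = {} \<longrightarrow> grown (insert a A) (X \<union> TV))"

lemma branch_empty: "r \<in> D \<Longrightarrow> branch a r {}"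
  unfolding branch_def using grown_mono[OF _ subset_insertI] by auto

lemma branch_leg:
  assumes "u \<in> V - D" "d \<in> D" "{u, d} \<in> E"
  shows "branch (l u d) d {u}"
  unfolding branch_def using assms tipped_imp_grown[OF tipped_leg] by auto

text \<open>\<open>x\<close> is attached by its leg of colour \<open>f x\<close>; the edge from
  \<open>v\<close> to \<open>x\<close> has the third colour, which differs from
  \<open>f x\<close>.\<close>

lemma branch_path2:
  assumes v: "v \<in> V - D" and x: "x \<in> V - D" and vx: "{v, x} \<in> E" "f v \<noteq> f x"
  shows "\<exists>r. branch (f x) r {v, x}"
proof -
  obtain d where d: "d \<in> D" "{x, d} \<in> E" "l x d = f x" using primary[OF x] by blast
  have ne: "third (f v) (f x) \<noteq> f x" using third_eq_iff[OF f3 f3 f3 vx(2)] by simp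
  have "grown (insert (f x) A) ({v, x} \<union> TV)"
    if g: "grown A TV" "f x \<notin> A" "d \<in> TV" "{v, x} \<inter> TV = {}" for A TV
  proof -
    have "tipped (insert (f x) A) (insert x TV) x (f x)"
      using tipped_leg[OF g(1) d(1) g(3) x _ d(2)] g d by auto
    from tipped_step[OF this v _ vx(1) ne]
    show ?thesis using g(4) vx(2) tipped_imp_grown by auto
  qed
  then show ?thesis using d v x unfolding branch_def by (intro exI[of _ d]) blast
qed

text \<open>From \<open>D\<close> outwards the path has the new colours \<open>f y\<close>,
  \<open>f v\<close>, \<open>f y\<close>, so consecutive edges differ, and its only leg has colour
  \<open>f y\<close>.\<close>

lemma branch_path3:
  assumes v: "v \<in> V - D" and x: "x \<in> V - D" and y: "y \<in> V - D"
    and e: "{v, x} \<in> E" "{x, y} \<in> E" and f: "f v \<noteq> f x" "f v \<noteq> f y" "f x \<noteq> f y"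
  shows "\<exists>r. branch (f y) r {v, x, y}"
proof -
  obtain d where d: "d \<in> D" "{y, d} \<in> E" "l y d = f y" using primary[OF y] by blast
  have th: "third (f x) (f y) = f v" "third (f v) (f x) = f y"
    using third_eq_iff[OF f3 f3 f3 f(1)] third_eq_iff[OF f3 f3 f3 f(3)] f by auto
  have "grown (insert (f y) A) ({v, x, y} \<union> TV)"
    if g: "grown A TV" "f y \<notin> A" "d \<in> TV" "{v, x, y} \<inter> TV = {}" for A TV
  proof -
    have "tipped (insert (f y) A) (insert y TV) y (f y)"
      using tipped_leg[OF g(1) d(1) g(3) y _ d(2)] g d by auto
    from tipped_step[OF this x _ e(2)]
    have "tipped (insert (f y) A) (insert x (insert y TV)) x (f v)"
      using g(4) f th by auto
    from tipped_step[OF this v _ e(1)]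
    show ?thesis using g(4) f th tipped_imp_grown by auto
  qed
  then show ?thesis using d v x y unfolding branch_def by (intro exI[of _ d]) blast
qed

lemma grown_core:
  assumes "r \<in> D" "s \<in> D" "t \<in> D"
  shows "\<exists>TV\<subseteq>D. {r, s, t} \<subseteq> TV \<and> grown {} TV"
proof -
  obtain TV TE where T: "TV \<subseteq> D" "TE \<subseteq> induced_edges E D" "is_tree TV TE" "{r, s, t} \<subseteq> TV"
    "proper_edges c TE"
    using core_trees[OF assms] unfolding has_proper_S_tree_def by blast
  have eq: "ext e = c e" "c e < k" "e \<in> E" if "e \<in> TE" for e
    using that T(2) c_less by (auto simp: ext_def induced_edges_def)
  have "grown {} TV"
    unfolding grown_def growth_def using T eq DV
    by (intro exI[of _ TE]) (auto simp: proper_edges_def)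
  then show ?thesis using T by blast
qed

lemma three_branches:
  assumes b: "branch a1 r1 X1" "branch a2 r2 X2" "branch a3 r3 X3"
    and a: "a1 \<noteq> a2" "a1 \<noteq> a3" "a2 \<noteq> a3"
    and X: "X1 \<inter> X2 = {}" "X1 \<inter> X3 = {}" "X2 \<inter> X3 = {}"
    and S: "S \<subseteq> {r1, r2, r3} \<union> X1 \<union> X2 \<union> X3"
  shows "has_proper_S_tree V E ext S"
proof -
  have r: "r1 \<in> D" "r2 \<in> D" "r3 \<in> D" and XD: "X1 \<inter> D = {}" "X2 \<inter> D = {}" "X3 \<inter> D = {}"
    using b unfolding branch_def by auto
  obtain TV where TV: "TV \<subseteq> D" "{r1, r2, r3} \<subseteq> TV" "grown {} TV" using grown_core[OF r] by blast
  have g1: "grown {a1} (X1 \<union> TV)"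
    using b(1) TV XD unfolding branch_def by (metis disjoint_iff empty_iff insert_subset subsetD)
  have "grown {a2, a1} (X2 \<union> (X1 \<union> TV))"
  proof -
    have "X2 \<inter> (X1 \<union> TV) = {}" "r2 \<in> X1 \<union> TV" using X XD TV by auto
    then show ?thesis using b(2) g1 a unfolding branch_def by (metis singletonD)
  qed
  moreover have "X3 \<inter> (X2 \<union> (X1 \<union> TV)) = {}" "r3 \<in> X2 \<union> (X1 \<union> TV)" "a3 \<notin> {a2, a1}"
    using X XD TV a by auto
  ultimately have "grown {a3, a2, a1} (X3 \<union> (X2 \<union> (X1 \<union> TV)))" (is "grown _ ?W")
    using b(3) unfolding branch_def by blast
  then obtain TE where "growth {a3, a2, a1} ?W TE" unfolding grown_def by blast
  moreover have "S \<subseteq> ?W" using S TV(2) by auto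
  ultimately show ?thesis unfolding growth_def has_proper_S_tree_def by meson
qed

section \<open>Covering triples by branches\<close>

text \<open>Vertices of the branch other than \<open>v\<close> have colour \<open>b\<close>, which
  later keeps branches disjoint.\<close>

definition sees :: "'a \<Rightarrow> nat \<Rightarrow> bool" where
  "sees v b \<longleftrightarrow> (\<exists>r X. branch b r X \<and> v \<in> insert r X \<and> X \<subseteq> insert v {x. f x = b})"

lemma sees_core: "v \<in> D \<Longrightarrow> sees v b"
  unfolding sees_def using branch_empty by blast

lemma sees_leg: "u \<in> V - D \<Longrightarrow> d \<in> D \<Longrightarrow> {u, d} \<in> E \<Longrightarrow> sees u (l u d)"
  unfolding sees_def using branch_leg by blast

lemma sees_nbr: "u \<in> V - D \<Longrightarrow> x \<in> V - D \<Longrightarrow> {u, x} \<in> E \<Longrightarrow> f u \<noteq> f x \<Longrightarrow> sees u (f x)"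
  unfolding sees_def using branch_path2[of u x] by blast

text \<open>A vertex of \<open>D\<close> has an empty branch of every colour, so any value of
  \<open>f v\<close> will do there; outside \<open>D\<close> the leg of colour \<open>f v\<close> is
  taken.\<close>

lemma own_branch:
  assumes "v \<in> V"
  shows "\<exists>r X. branch (f v) r X \<and> v \<in> insert r X \<and> X \<subseteq> {v}"
proof (cases "v \<in> D")
  case True
  then show ?thesis using branch_empty by blast
next
  case False
  then obtain d where "d \<in> D" "{v, d} \<in> E" "l v d = f v" using primary assms by blast
  then show ?thesis using branch_leg[of v d] assms False by auto
qed

text \<open>Each of the first three alternatives in \<open>cases\<close> lets \<open>v\<close> see
  two colours other than \<open>f v\<close>, and there are no more than two. The fourth alternative
  is the rainbow path.\<close>

lemma sees_all_or_rainbow_end: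
  assumes v: "v \<in> V"
  shows "(\<forall>b<3. b \<noteq> f v \<longrightarrow> sees v b) \<or> v \<in> V - D \<and>
    (\<exists>x\<in>V - D. \<exists>y\<in>V - D. {v, x} \<in> E \<and> {x, y} \<in> E \<and> f v \<noteq> f x \<and> f v \<noteq> f y \<and> f x \<noteq> f y)"
proof (cases "v \<in> D")
  case True
  then show ?thesis using sees_core by blast
next
  case False
  then have vU: "v \<in> V - D" using v by blast
  have two: "\<forall>b<3. b \<noteq> f v \<longrightarrow> sees v b"
    if "sees v a" "sees v a'" "a < 3" "a' < 3" "a \<noteq> f v" "a' \<noteq> f v" "a \<noteq> a'" for a a'
    using that f3[of v] by (auto simp: less_3_cases)
  from cases[OF vU] show ?thesis
  proof (elim disjE bexE conjE)
    assume "\<forall>b<3. \<exists>d\<in>D. {v, d} \<in> E \<and> l v d = b"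
    then show ?thesis using sees_leg[OF vU] by metis
  next
    fix d x assume "d \<in> D" "x \<in> V - D" "{v, d} \<in> E" "{v, x} \<in> E" "f x \<noteq> f v" "l v d \<noteq> f v" "l v d \<noteq> f x"
    then show ?thesis using two[of "l v d" "f x"] sees_leg[OF vU] sees_nbr[OF vU, of x] f3 l3 by metis
  next
    fix x y assume "x \<in> V - D" "y \<in> V - D" "{v, x} \<in> E" "{v, y} \<in> E" "f v \<noteq> f x" "f v \<noteq> f y" "f x \<noteq> f y"
    then show ?thesis using two[of "f x" "f y"] sees_nbr[OF vU] f3 by metis
  qed (use vU in blast)
qed

text \<open>Both leg colours avoid \<open>f p\<close>, which stays free for the own leg of a third
  vertex of that colour; the last condition keeps this vertex off both branches.\<close>

definition split_pair :: "'a \<Rightarrow> 'a \<Rightarrow> bool" where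
  "split_pair p q \<longleftrightarrow> (\<exists>b d r s X Y. branch b r X \<and> branch d s Y \<and> b \<noteq> d \<and> b \<noteq> f p \<and> d \<noteq> f p \<and>
     X \<inter> Y = {} \<and> {p, q} \<subseteq> {r, s} \<union> X \<union> Y \<and> X \<union> Y \<subseteq> {p, q} \<union> {x. f x \<noteq> f p})"

lemma split_pair_commute: "f p = f q \<Longrightarrow> split_pair p q \<Longrightarrow> split_pair q p"
  unfolding split_pair_def by (simp add: insert_commute)

lemma split_pairI:
  assumes "branch b r X" "branch d s Y" "b \<noteq> d" "b \<noteq> f p" "d \<noteq> f p" "X \<inter> Y = {}"
    "p \<in> insert r X" "q \<in> insert s Y" "X \<subseteq> insert p {x. f x \<noteq> f p}" "Y \<subseteq> insert q {x. f x \<noteq> f p}"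
  shows "split_pair p q"
  unfolding split_pair_def
  by (rule exI[of _ b], rule exI[of _ d], rule exI[of _ r], rule exI[of _ s], rule exI[of _ X],
      rule exI[of _ Y]) (use assms in blast)

lemma split_pair_sees:
  assumes pq: "p \<noteq> q" "f p = f q" and s: "sees p b" "sees q d" and b: "b \<noteq> d" "b \<noteq> f p" "d \<noteq> f p"
  shows "split_pair p q"
proof -
  obtain r X where X: "branch b r X" "p \<in> insert r X" "X \<subseteq> insert p {x. f x = b}"
    using s(1) unfolding sees_def by blast
  obtain s Y where Y: "branch d s Y" "q \<in> insert s Y" "Y \<subseteq> insert q {x. f x = d}"
    using s(2) unfolding sees_def by blast
  show ?thesis
    by (rule split_pairI[OF X(1) Y(1) b _ X(2) Y(2)]) (use X(3) Y(3) pq b in auto)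
qed

text \<open>Meant for neighbours \<open>z\<close> and \<open>x\<close> of the same colour:
  \<open>p\<close> goes through \<open>z\<close> to a leg of colour \<open>f z\<close>, while
  \<open>q\<close> follows its rainbow path to a leg of colour \<open>f y\<close>. The branches are
  disjoint since \<open>z \<noteq> x\<close>.\<close>

lemma split_pair_path:
  assumes pq: "p \<noteq> q" "f p = f q" and p: "p \<in> V - D" and q: "q \<in> V - D"
    and z: "z \<in> V - D" "{p, z} \<in> E"
    and x: "x \<in> V - D" "{q, x} \<in> E" and y: "y \<in> V - D" "{x, y} \<in> E"
    and f: "f q \<noteq> f x" "f q \<noteq> f y" "f x \<noteq> f y" "f z = f x" and zx: "z \<noteq> x"
  shows "split_pair p q"
proof -
  obtain r where r: "branch (f z) r {p, z}" using branch_path2[OF p z(1,2)] f pq by auto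
  obtain s where s: "branch (f y) s {q, x, y}" using branch_path3[OF q x(1) y(1) x(2) y(2) f(1-3)] by blast
  show ?thesis
    by (rule split_pairI[OF r s]) (use f pq zx in auto)
qed

text \<open>Each vertex sees some colour other than its own, so a vertex seeing both can choose the
  one not taken by its partner. Two rainbow ends clash only if the next vertices on their paths have
  the same colour; if these vertices differ, \<open>q\<close> follows its whole path, and if they
  coincide, \<open>separation\<close> gives \<open>p\<close> another way.\<close>

lemma split_pair_mono:
  assumes V: "p \<in> V" "q \<in> V" and pq: "p \<noteq> q" "f p = f q"
  shows "split_pair p q"
proof -
  have sees_some: "\<exists>b<3. b \<noteq> f v \<and> sees v b" if "v \<in> V" for v
  proof -
    have "\<exists>b<3. b \<noteq> f v" by (rule exI[of _ "if f v = 0 then 1 else 0"]) auto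
    then show ?thesis using sees_all_or_rainbow_end[OF that] sees_nbr f3 by metis
  qed
  have full: "split_pair u v"
    if all: "\<forall>b<3. b \<noteq> f u \<longrightarrow> sees u b" and v: "v \<in> V" "u \<noteq> v" "f u = f v" for u v
  proof -
    obtain b where b: "b < 3" "b \<noteq> f v" "sees v b" using sees_some[OF v(1)] by blast
    have "third (f v) b < 3" "third (f v) b \<noteq> f v" "third (f v) b \<noteq> b"
      using third_eq_iff[of "f v" b "third (f v) b"] f3 b third_less by auto
    then show ?thesis using split_pair_sees[of u v "third (f v) b" b] all v b by auto
  qed
  show ?thesis
  proof (cases "(\<forall>b<3. b \<noteq> f p \<longrightarrow> sees p b) \<or> (\<forall>b<3. b \<noteq> f q \<longrightarrow> sees q b)")
    case True
    then show ?thesis using full[of p q] full[of q p] V pq split_pair_commute[of q p] by metis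
  next
    case False
    then obtain x y x' y' where p: "p \<in> V - D" and q: "q \<in> V - D"
      and x: "x \<in> V - D" "{p, x} \<in> E" and y: "y \<in> V - D" "{x, y} \<in> E"
      and f: "f p \<noteq> f x" "f p \<noteq> f y" "f x \<noteq> f y"
      and x': "x' \<in> V - D" "{q, x'} \<in> E" and y': "y' \<in> V - D" "{x', y'} \<in> E"
      and f': "f q \<noteq> f x'" "f q \<noteq> f y'" "f x' \<noteq> f y'"
      using sees_all_or_rainbow_end[OF V(1)] sees_all_or_rainbow_end[OF V(2)] by blast
    have sp: "sees p (f x)" and sq: "sees q (f x')" using sees_nbr p q x x' f f' by auto
    show ?thesis
    proof (cases "f x = f x'")
      case False
      then show ?thesis using split_pair_sees[OF pq sp sq] f f' pq by auto
    next
      case same: True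
      show ?thesis
      proof (cases "x = x'")
        case False
        then show ?thesis using split_pair_path[OF pq p q x x' y' f'] same by blast
      next
        case eq: True
        from separation[OF p q x(1) pq x(2)] x' eq f
        consider z where "z \<in> V - D" "z \<noteq> x" "{p, z} \<in> E" "f z \<noteq> f p"
          | d where "d \<in> D" "{p, d} \<in> E" "l p d \<noteq> f p" "l p d \<noteq> f x"
          by metis
        then show ?thesis
        proof cases
          case 1
          show ?thesis
          proof (cases "f z = f x'")
            case True
            then show ?thesis using split_pair_path[OF pq p q 1(1,3) x' y' f'] 1 eq by blast
          next
            case False
            have "sees p (f z)" using sees_nbr[OF p 1(1,3)] 1 by metis
            then show ?thesis using split_pair_sees[OF pq _ sq] False 1 f' pq by metis
          qed
        next
          case 2
          have "sees p (l p d)" using sees_leg[OF p 2(1,2)] .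
          then show ?thesis using split_pair_sees[OF pq _ sq] 2 f f' pq eq by metis
        qed
      qed
    qed
  qed
qed

text \<open>\<open>u\<close> and \<open>w\<close> take their own legs, so \<open>v\<close> has to
  reach \<open>D\<close> with the remaining colour \<open>t\<close>. If \<open>v\<close> does not
  see \<open>t\<close>, its rainbow path has \<open>f x = f w\<close> and \<open>f y = t\<close>,
  hence continues to a leg of colour \<open>t\<close>.\<close>

lemma triple_two_colours:
  assumes V: "u \<in> V" "v \<in> V" "w \<in> V" and uv: "u \<noteq> v" "f u = f v" "f w \<noteq> f u"
  shows "has_proper_S_tree V E ext {u, v, w}"
proof -
  define t where "t = third (f u) (f w)"
  have t: "t < 3" "t \<noteq> f u" "t \<noteq> f w"
    using third_eq_iff[of "f u" "f w" t] f3 uv third_less by (auto simp: t_def)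
  have tu: "a = t" if "a < 3" "a \<noteq> f u" "a \<noteq> f w" for a
    using third_eq_iff[of "f u" "f w" a] f3 uv that by (auto simp: t_def)
  obtain r X where X: "branch (f u) r X" "u \<in> insert r X" "X \<subseteq> {u}" using own_branch[OF V(1)] by blast
  obtain s Y where Y: "branch (f w) s Y" "w \<in> insert s Y" "Y \<subseteq> {w}" using own_branch[OF V(3)] by blast
  show ?thesis
  proof (cases "sees v t")
    case True
    then obtain q Z where Z: "branch t q Z" "v \<in> insert q Z" "Z \<subseteq> insert v {x. f x = t}"
      unfolding sees_def by blast
    show ?thesis
      by (rule three_branches[OF X(1) Y(1) Z(1)]) (use X Y Z uv t in auto)
  next
    case False
    then obtain x y where v: "v \<in> V - D" and x: "x \<in> V - D" "{v, x} \<in> E"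
      and y: "y \<in> V - D" "{x, y} \<in> E" and f: "f v \<noteq> f x" "f v \<noteq> f y" "f x \<noteq> f y"
      using sees_all_or_rainbow_end[OF V(2)] t uv by metis
    have "f x \<noteq> t" using sees_nbr[OF v x f(1)] False by metis
    then have fx: "f x = f w" using tu[OF f3, of x] f uv by metis
    then have fy: "f y = t" using tu[OF f3, of y] f uv by metis
    obtain q where Z: "branch t q {v, x, y}"
      using branch_path3[OF v x(1) y(1) x(2) y(2) f] fy by auto
    have wy: "w \<noteq> y" "u \<noteq> x" "u \<noteq> y" "v \<noteq> w" using fy t uv fx by auto
    show ?thesis
    proof (cases "x = w")
      case True
      \<comment> \<open>The path through \<open>x = w\<close> already covers \<open>w\<close>, so an
        empty branch replaces that of \<open>w\<close>.\<close>
      have s: "branch (f w) s {}" using Y branch_empty unfolding branch_def by blast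
      show ?thesis
        by (rule three_branches[OF X(1) s Z]) (use X uv t wy True in auto)
    next
      case False
      show ?thesis
        by (rule three_branches[OF X(1) Y(1) Z]) (use X Y uv t wy False in auto)
    qed
  qed
qed

lemma triple_has_tree:
  assumes V: "u \<in> V" "v \<in> V" "w \<in> V" and ne: "u \<noteq> v" "u \<noteq> w" "v \<noteq> w"
  shows "has_proper_S_tree V E ext {u, v, w}"
proof -
  consider (distinct) "f u \<noteq> f v" "f u \<noteq> f w" "f v \<noteq> f w"
    | (mono) "f u = f v" "f u = f w"
    | (uv) "f u = f v" "f w \<noteq> f u" | (uw) "f u = f w" "f v \<noteq> f u" | (vw) "f v = f w" "f u \<noteq> f v"
    by metis
  then show ?thesis
  proof cases
    case distinct
    obtain r X where X: "branch (f u) r X" "u \<in> insert r X" "X \<subseteq> {u}" using own_branch[OF V(1)] by blast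
    obtain s Y where Y: "branch (f v) s Y" "v \<in> insert s Y" "Y \<subseteq> {v}" using own_branch[OF V(2)] by blast
    obtain t Z where Z: "branch (f w) t Z" "w \<in> insert t Z" "Z \<subseteq> {w}" using own_branch[OF V(3)] by blast
    show ?thesis
      by (rule three_branches[OF X(1) Y(1) Z(1) distinct]) (use X Y Z ne in auto)
  next
    case mono
    obtain t Z where Z: "branch (f w) t Z" "w \<in> insert t Z" "Z \<subseteq> {w}" using own_branch[OF V(3)] by blast
    obtain b d r s X Y where B: "branch b r X" "branch d s Y" "b \<noteq> d" "b \<noteq> f u" "d \<noteq> f u"
      "X \<inter> Y = {}" "{u, v} \<subseteq> {r, s} \<union> X \<union> Y" "X \<union> Y \<subseteq> {u, v} \<union> {x. f x \<noteq> f u}"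
      using split_pair_mono[OF V(1,2) ne(1) mono(1)] unfolding split_pair_def
      by (elim exE conjE) (rule that)
    \<comment> \<open>Only \<open>u\<close> and \<open>v\<close> may have colour \<open>f u\<close>
      on these branches.\<close>
    have "w \<notin> X \<union> Y" using B(8) ne mono by auto
    then show ?thesis
      by (intro three_branches[OF B(1,2) Z(1) B(3)]) (use Z B mono in auto)
  next
    case uv
    then show ?thesis using triple_two_colours V ne by blast
  next
    case uw
    then show ?thesis using triple_two_colours[of u w v] V ne by (simp add: insert_commute)
  next
    case vw
    then show ?thesis using triple_two_colours[of v w u] V ne by (simp add: insert_commute)
  qed
qed

lemma px3_le_add_3:
  assumes "card V \<ge> 3"
  shows "px3 V E \<le> k + 3"
proof (rule px3_le[OF ext_range])
  have "has_proper_S_tree V E ext S" if "S \<subseteq> V" "card S = 3" for S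
    using that triple_has_tree by (auto simp: card_3_iff)
  then show "three_proper V E ext" using assms by (simp add: three_proper_def)
qed

end

text \<open>Colours are given out by priority: \<open>a\<close> first, \<open>b\<close> to a second
  leg, the remaining one to a third leg; further legs repeat \<open>a\<close>.\<close>

lemma leg_colours_exist:
  assumes ab: "a < 3" "b < 3" "a \<noteq> b" and L: "finite L" "L \<noteq> {}"
  shows "\<exists>g :: 'a \<Rightarrow> nat. (\<forall>d. g d < 3) \<and> a \<in> g ` L \<and> (card L \<ge> 2 \<longrightarrow> b \<in> g ` L) \<and>
    (card L \<ge> 3 \<longrightarrow> (\<forall>c<3. c \<in> g ` L))"
proof -
  obtain xs where xs: "set xs = L" "distinct xs" using finite_distinct_list[OF L(1)] by blast
  have len: "length xs = card L" using xs distinct_card by metis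
  obtain x ys where x: "xs = x # ys" using xs L by (cases xs) auto
  consider "ys = []" | y where "ys = [y]" | y z zs where "ys = y # z # zs"
    by (cases ys; cases "tl ys") auto
  then show ?thesis
  proof cases
    case 1
    then show ?thesis using x xs ab len by (intro exI[of _ "\<lambda>_. a"]) auto
  next
    case 2
    then show ?thesis using x xs ab len by (intro exI[of _ "(\<lambda>_. a)(y := b)"]) auto
  next
    case 3
    let ?g = "(\<lambda>_. a)(y := b, z := third a b)"
    have mem: "x \<in> L" "y \<in> L" "z \<in> L" "x \<noteq> y" "x \<noteq> z" "y \<noteq> z" using 3 x xs by auto
    then have im: "a \<in> ?g ` L" "b \<in> ?g ` L" "third a b \<in> ?g ` L"
      by (auto simp: image_iff intro: bexI[of _ x] bexI[of _ y] bexI[of _ z])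
    moreover have "c \<in> ?g ` L" if "c < 3" for c
      using im third_eq_iff[OF ab(1,2) that ab(3)] by metis
    moreover have "\<forall>d. ?g d < 3" using ab third_less by auto
    ultimately show ?thesis by blast
  qed
qed

section \<open>The upper bound for a connected 3-way dominating set\<close>

lemma px3_three_way_dominating:
  assumes G: "sgraph V E" and DV: "D \<subseteq> V" and D: "connected_three_way_dominating V E D"
  shows "px3 V E \<le> px3 D (induced_edges E D) + 3"
proof (cases "V = D")
  case True
  then have "induced_edges E D = E" using G by (auto simp: induced_edges_def sgraph_def)
  then show ?thesis using True by simp
next
  case False
  have dom: "\<And>v. v \<in> V - D \<Longrightarrow> \<exists>u\<in>D. {u, v} \<in> E" and deg: "\<And>v. v \<in> V - D \<Longrightarrow> 3 \<le> card {u. {u, v} \<in> E}"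
    using D by (auto simp: connected_three_way_dominating_def three_way_dominating_def
        dominating_def degree_def)
  define U where "U = V - D"
  define L where "L u = {d\<in>D. {u, d} \<in> E}" for u
  define adj where "adj x y \<longleftrightarrow> {x, y} \<in> E" for x y
  have finV: "finite V" using G by (simp add: sgraph_def)
  have finL: "finite (L u)" for u using finV DV finite_subset unfolding L_def by fastforce
  have GD: "sgraph D (induced_edges E D)"
    unfolding sgraph_def
  proof (intro conjI ballI)
    fix e assume e: "e \<in> induced_edges E D"
    then have "e \<in> E" by (simp add: induced_edges_def)
    then obtain u v where "u \<noteq> v" "e = {u, v}"
      using G unfolding sgraph_def by meson
    then show "\<exists>u v. u \<noteq> v \<and> u \<in> D \<and> v \<in> D \<and> e = {u, v}"
      using e by (auto simp: induced_edges_def)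
  qed (use finV DV finite_subset in blast)
  have LU: "L u \<noteq> {}" if u: "u \<in> U" for u
  proof -
    obtain d where "d \<in> D" "{d, u} \<in> E"
      using dom[of u] u unfolding U_def by blast
    then show ?thesis by (auto simp: L_def insert_commute)
  qed
  \<comment> \<open>Counting neighbours in \<open>D\<close> and outer neighbours separately yields
    the last two assumptions of \<open>leg_demand\<close>.\<close>
  have degree: "3 \<le> card (L u) + card {x\<in>U. adj u x}" if "u \<in> U" for u
  proof -
    have "3 \<le> card {x. {x, u} \<in> E}" using deg[of u] that by (simp add: U_def)
    also have "{x. {x, u} \<in> E} = L u \<union> {x\<in>U. adj u x}"
      using sgraph_edgeD(2)[OF G] by (auto simp: L_def adj_def U_def insert_commute)
    also have "card \<dots> \<le> card (L u) + card {x\<in>U. adj u x}" by (rule card_Un_le)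
    finally show ?thesis .
  qed
  interpret leg_demand U adj "\<lambda>u. card (L u)"
  proof
    show "finite U" using finV by (simp add: U_def)
    show "adj y x" if "adj x y" for x y using that by (simp add: adj_def insert_commute)
    show "\<not> adj x x" for x using sgraph_edgeD(1)[OF G, of x x] by (auto simp: adj_def)
    show "\<exists>x\<in>U. \<exists>y\<in>U. x \<noteq> y \<and> adj v x \<and> adj v y" if "v \<in> U" "card (L v) \<le> 1" for v
    proof -
      have "2 \<le> card {x\<in>U. adj v x}" using degree[OF that(1)] that(2) by linarith
      then obtain T where "T \<subseteq> {x\<in>U. adj v x}" "card T = 2" using obtain_subset_with_card_n by metis
      then show ?thesis by (auto simp: card_2_iff)
    qed
    show "\<exists>x\<in>U. adj v x" if "v \<in> U" "card (L v) \<le> 2" for v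
    proof -
      have "{x\<in>U. adj v x} \<noteq> {}" using degree[OF that(1)] that(2) by (auto simp del: Collect_empty_eq)
      then show ?thesis by blast
    qed
  qed
  obtain f where f3: "\<And>v. f v < 3" and served: "\<And>v. v \<in> U \<Longrightarrow> served U adj (\<lambda>u. card (L u)) f v"
    and sep: "\<And>u v x. u \<in> U \<Longrightarrow> v \<in> U \<Longrightarrow> x \<in> U \<Longrightarrow> u \<noteq> v \<Longrightarrow> f u = f v \<Longrightarrow> adj u x \<Longrightarrow> adj v x \<Longrightarrow>
       f x \<noteq> f u \<Longrightarrow> card (L u) \<le> 1 \<Longrightarrow> \<exists>z\<in>U. z \<noteq> x \<and> adj u z \<and> f z \<noteq> f u"
    using serving_separating_exists by blast
  \<comment> \<open>This \<open>b\<close> is the colour for a second leg of \<open>u\<close>: if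
    \<open>u\<close> has neighbours of colours other than \<open>f u\<close>, one of them also
    differs from \<open>b\<close>, so that neighbour and leg together offer both missing
    colours.\<close>
  have "\<exists>b<3. b \<noteq> f u \<and>
      ((\<exists>x\<in>U. adj u x \<and> f x \<noteq> f u) \<longrightarrow> (\<exists>x\<in>U. adj u x \<and> f x \<noteq> f u \<and> f x \<noteq> b))" for u
  proof (cases "\<exists>x\<in>U. adj u x \<and> f x \<noteq> f u")
    case True
    then obtain x where x: "x \<in> U" "adj u x" "f x \<noteq> f u" by blast
    have "third (f u) (f x) \<noteq> f u" "third (f u) (f x) \<noteq> f x"
      using third_eq_iff[of "f u" "f x" "third (f u) (f x)"] f3 x third_less by auto
    then show ?thesis using x third_less by metis
  next
    case False
    have "\<exists>b<3. b \<noteq> f u" by (rule exI[of _ "if f u = 0 then 1 else 0"]) auto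
    then show ?thesis using False by blast
  qed
  then obtain b where b: "\<And>u. b u < 3" "\<And>u. b u \<noteq> f u"
    and bx: "\<And>u x. x \<in> U \<Longrightarrow> adj u x \<Longrightarrow> f x \<noteq> f u \<Longrightarrow> \<exists>x\<in>U. adj u x \<and> f x \<noteq> f u \<and> f x \<noteq> b u"
    by metis
  have "\<exists>g :: 'a \<Rightarrow> nat. (\<forall>d. g d < 3) \<and> (u \<in> U \<longrightarrow> f u \<in> g ` L u \<and> (card (L u) \<ge> 2 \<longrightarrow> b u \<in> g ` L u) \<and>
    (card (L u) \<ge> 3 \<longrightarrow> (\<forall>c<3. c \<in> g ` L u)))" for u
  proof (cases "u \<in> U")
    case True
    then show ?thesis
      using leg_colours_exist[OF f3 b(1) b(2)[symmetric] finL LU[OF True], of u] by blast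
  qed (auto intro: exI[of _ "\<lambda>_. 0"])
  then obtain l :: "'a \<Rightarrow> 'a \<Rightarrow> nat" where l3: "\<And>u d. l u d < 3" and l1: "\<And>u. u \<in> U \<Longrightarrow> f u \<in> l u ` L u"
    and l2: "\<And>u. u \<in> U \<Longrightarrow> card (L u) \<ge> 2 \<Longrightarrow> b u \<in> l u ` L u"
    and lall: "\<And>u a. u \<in> U \<Longrightarrow> card (L u) \<ge> 3 \<Longrightarrow> a < 3 \<Longrightarrow> a \<in> l u ` L u"
    by metis
  obtain c where c: "c ` induced_edges E D \<subseteq> {..<px3 D (induced_edges E D)}"
    "three_proper D (induced_edges E D) c"
    using px3_attained[OF GD] D unfolding connected_three_way_dominating_def by blast
  interpret leg_colouring V E D c "px3 D (induced_edges E D)" f l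
  proof
    show "c e < px3 D (induced_edges E D)" if "e \<in> induced_edges E D" for e using c(1) that by auto
    show "has_proper_S_tree D (induced_edges E D) c {r, s, t}" if "r \<in> D" "s \<in> D" "t \<in> D" for r s t
      using three_proper_triple[OF _ c(2) that] finV DV finite_subset by blast
    show "\<exists>d\<in>D. {u, d} \<in> E \<and> l u d = f u" if "u \<in> V - D" for u
      using l1[of u] that by (auto simp: U_def L_def)
    show "(\<forall>b<3. \<exists>d\<in>D. {u, d} \<in> E \<and> l u d = b) \<or>
      (\<exists>d\<in>D. \<exists>x\<in>V - D. {u, d} \<in> E \<and> {u, x} \<in> E \<and> f x \<noteq> f u \<and> l u d \<noteq> f u \<and> l u d \<noteq> f x) \<or>
      (\<exists>x\<in>V - D. \<exists>y\<in>V - D. {u, x} \<in> E \<and> {u, y} \<in> E \<and> f u \<noteq> f x \<and> f u \<noteq> f y \<and> f x \<noteq> f y) \<or>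
      (\<exists>x\<in>V - D. \<exists>y\<in>V - D. {u, x} \<in> E \<and> {x, y} \<in> E \<and> f u \<noteq> f x \<and> f u \<noteq> f y \<and> f x \<noteq> f y)"
      (is "?all \<or> ?leg \<or> ?mid \<or> ?end") if u: "u \<in> V - D" for u
    proof -
      have uU: "u \<in> U" using u by (simp add: U_def)
      from served[OF uU] consider "card (L u) \<ge> 3"
        | x where "card (L u) \<ge> 2" "x \<in> U" "adj u x" "f x \<noteq> f u"
        | x y z where "rainbow_path U adj f x y z" "u \<in> {x, y, z}"
        unfolding served_def by blast
      then show ?thesis
      proof cases
        case 1
        then have ?all using lall[OF uU] by (fastforce simp: L_def)
        then show ?thesis by blast
      next
        case 2
        obtain y where y: "y \<in> U" "adj u y" "f y \<noteq> f u" "f y \<noteq> b u" using bx[OF 2(2-4)] by blast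
        obtain d where d: "d \<in> D" "{u, d} \<in> E" "l u d = b u" using l2[OF uU 2(1)] by (auto simp: L_def)
        have ?leg using y d b(2)[of u] unfolding U_def adj_def by metis
        then show ?thesis by blast
      next
        case 3
        then have p: "x \<in> V - D" "y \<in> V - D" "z \<in> V - D" "{x, y} \<in> E" "{y, x} \<in> E" "{y, z} \<in> E" "{z, y} \<in> E"
          "f x \<noteq> f y" "f y \<noteq> f z" "f x \<noteq> f z"
          by (auto simp: rainbow_path_def U_def adj_def insert_commute)
        from 3(2) consider "u = x" | "u = y" | "u = z" by blast
        then show ?thesis
        proof cases
          case 1 then have ?end using p by blast
          then show ?thesis by blast
        next
          case 2 then have ?mid using p by metis
          then show ?thesis by blast
        next
          case 3 then have ?end using p by metis
          then show ?thesis by blast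
        qed
      qed
    qed
    show "(\<exists>z\<in>V - D. z \<noteq> x \<and> {u, z} \<in> E \<and> f z \<noteq> f u) \<or>
        (\<exists>d\<in>D. {u, d} \<in> E \<and> l u d \<noteq> f u \<and> l u d \<noteq> f x)"
      if st: "u \<in> V - D" "v \<in> V - D" "x \<in> V - D" "u \<noteq> v" "f u = f v" "{u, x} \<in> E" "{v, x} \<in> E" "f x \<noteq> f u"
      for u v x
    proof (cases "card (L u) \<le> 1")
      case True
      then show ?thesis using sep[of u v x] st unfolding U_def adj_def by blast
    next
      case False
      have uU: "u \<in> U" using st by (simp add: U_def)
      obtain y where y: "y \<in> U" "adj u y" "f y \<noteq> f u" "f y \<noteq> b u"
        using bx[of x u] st by (auto simp: U_def adj_def)
      obtain d where d: "d \<in> D" "{u, d} \<in> E" "l u d = b u"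
        using l2[OF uU] False by (auto simp: L_def)
      show ?thesis
      \<comment> \<open>Either the second leg avoids \<open>f x\<close>, or
        \<open>f x = b u\<close>, and then \<open>y \<noteq> x\<close> because
        \<open>f y \<noteq> b u\<close>.\<close>
      proof (cases "b u = f x")
        case True
        then show ?thesis using y unfolding U_def adj_def by metis
      next
        case False
        then show ?thesis using d b(2)[of u] by metis
      qed
    qed
  qed (rule G DV f3 l3)+
  \<comment> \<open>An outer vertex has three neighbours, so \<open>V\<close> has at least three
    vertices and the small case of \<open>three_proper\<close> does not arise.\<close>
  obtain u where u: "u \<in> V - D" using False DV by blast
  have "3 \<le> card {x. {x, u} \<in> E}"
    using deg[OF u] .
  also have "\<dots> \<le> card V" using sgraph_edgeD(2)[OF G] by (intro card_mono finV) auto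
  finally show ?thesis by (rule px3_le_add_3)
qed

section \<open>Cliques glued at a vertex\<close>

lemma glued_V_iff: "(j, t) \<in> glued_V p i \<longleftrightarrow>
    1 \<le> p \<and> j = 0 \<and> t = 0 \<or> 1 \<le> j \<and> j \<le> p \<and> 1 \<le> t \<and> t < i j"
  unfolding glued_V_def clique_verts_def by force

lemma glued_E_I:
  "x \<in> clique_verts i j \<Longrightarrow> y \<in> clique_verts i j \<Longrightarrow> x \<noteq> y \<Longrightarrow> 1 \<le> j \<Longrightarrow> j \<le> p \<Longrightarrow> {x, y} \<in> glued_E p i"
  unfolding glued_E_def by (intro CollectI exI[of _ x] exI[of _ y]) auto

lemma glued_E_centre: "1 \<le> j \<Longrightarrow> j \<le> p \<Longrightarrow> 1 \<le> t \<Longrightarrow> t < i j \<Longrightarrow> {(0, 0), (j, t)} \<in> glued_E p i"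
  by (rule glued_E_I[of _ i j]) (auto simp: clique_verts_def)

lemma glued_E_clique:
  "1 \<le> j \<Longrightarrow> j \<le> p \<Longrightarrow> 1 \<le> t \<Longrightarrow> t < i j \<Longrightarrow> 1 \<le> s \<Longrightarrow> s < i j \<Longrightarrow> s \<noteq> t \<Longrightarrow> {(j, s), (j, t)} \<in> glued_E p i"
  by (rule glued_E_I[of _ i j]) (auto simp: clique_verts_def)

text \<open>The centre \<open>(0, 0)\<close> separates the cliques: other vertices of different
  cliques are never adjacent.\<close>

lemma glued_E_leave:
  assumes "{(j, t), y} \<in> glued_E p i" "j \<noteq> 0" "fst y \<noteq> j"
  shows "y = (0, 0)"
  using assms unfolding glued_E_def clique_verts_def by (auto simp: doubleton_eq_iff)

lemma sgraph_glued: "sgraph (glued_V p i) (glued_E p i)"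
proof -
  have "finite (clique_verts i j)" for j
    unfolding clique_verts_def by simp
  then show ?thesis unfolding sgraph_def glued_V_def glued_E_def by blast
qed

lemma gconnected_glued:
  assumes "1 \<le> p"
  shows "gconnected (glued_V p i) (glued_E p i)"
proof (rule gconnected_rootI[of "(0, 0)"])
  fix v assume "v \<in> glued_V p i"
  then have "v = (0, 0) \<or> {(0, 0), v} \<in> glued_E p i"
    using glued_E_centre by (cases v) (auto simp: glued_V_iff)
  then show "((0, 0), v) \<in> (adj_rel (glued_E p i))\<^sup>*" by (auto simp: adj_rel_def)
qed (use assms in \<open>simp add: glued_V_iff\<close>)

lemma glued_dominating:
  assumes p: "1 \<le> p" and i: "\<forall>j\<in>{1..p}. i j \<ge> 4"
  shows "connected_three_way_dominating (glued_V p i) (glued_E p i) {(0, 0)}"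
proof -
  have "dominating (glued_V p i) (glued_E p i) {(0, 0)}"
    using p glued_E_centre by (auto simp: dominating_def glued_V_iff)
  moreover have "degree (glued_E p i) v \<ge> 3" if v: "v \<in> glued_V p i - {(0, 0)}" for v
  proof -
    obtain j t where vjt: "v = (j, t)" by (cases v)
    then have jt: "1 \<le> j" "j \<le> p" "1 \<le> t" "t < i j" using v by (auto simp: glued_V_iff)
    have i4: "i j \<ge> 4" using i jt by auto
    \<comment> \<open>These are the centre and the \<open>i j - 2\<close> further vertices of the
      clique, so the degree is at least \<open>i j - 1\<close>.\<close>
    let ?N = "insert (0, 0) (Pair j ` ({1..<i j} - {t}))"
    have sub: "?N \<subseteq> {u. {u, (j, t)} \<in> glued_E p i}"
      using glued_E_centre[of j p t i] glued_E_clique[of j p t i] jt by auto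
    have "finite {u. {u, (j, t)} \<in> glued_E p i}"
      by (rule finite_subset[of _ "glued_V p i"])
        (use sgraph_edgeD(2)[OF sgraph_glued] sgraph_glued in \<open>auto simp: sgraph_def\<close>)
    then have "card ?N \<le> degree (glued_E p i) (j, t)"
      unfolding degree_def using sub by (rule card_mono)
    moreover have "card (Pair j ` ({1..<i j} - {t})) = i j - 2"
      using jt by (subst card_image) (auto simp: inj_on_def)
    then have "card ?N = Suc (i j - 2)" using jt by (subst card_insert_disjoint) auto
    ultimately show ?thesis using i4 unfolding vjt by linarith
  qed
  moreover have "gconnected {(0, 0)} F" for F :: "(nat \<times> nat) set set" by (auto simp: gconnected_def)
  ultimately show ?thesis
    unfolding connected_three_way_dominating_def three_way_dominating_def by blast
qed

text \<open>A tree through non-central vertices of three cliques leaves each of these cliques by an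
  edge to the centre; the three edges are pairwise adjacent and so have three colours.\<close>

lemma px3_glued_ge:
  assumes p: "3 \<le> p" and i: "\<forall>j\<in>{1..p}. i j \<ge> 4"
  shows "3 \<le> px3 (glued_V p i) (glued_E p i)"
proof -
  let ?V = "glued_V p i" and ?E = "glued_E p i"
  have "1 \<le> p" using p by simp
  from px3_attained[OF sgraph_glued gconnected_glued[OF this]] obtain c
    where c: "c ` ?E \<subseteq> {..<px3 ?V ?E}" "three_proper ?V ?E c" by blast
  have fin: "finite ?V" using sgraph_glued by (auto simp: sgraph_def)
  have "(j, 1) \<in> ?V" if "j \<in> {1, 2, 3}" for j
  proof -
    have "j \<in> {1..p}" using that p by auto
    then show ?thesis using bspec[OF i, of j] by (auto simp: glued_V_iff)
  qed
  then have "has_proper_S_tree ?V ?E c {(1, 1), (2, 1), (3, 1)}"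
    by (intro three_proper_triple[OF fin c(2)]) auto
  then obtain TV TE where T: "TE \<subseteq> ?E" "is_tree TV TE" "{(1, 1), (2, 1), (3, 1)} \<subseteq> TV"
    "proper_edges c TE"
    unfolding has_proper_S_tree_def by blast
  have cut: "\<exists>t. {(j, t), (0, 0)} \<in> TE"
    if "(j, 1) \<in> TV" "(h, 1) \<in> TV" "j \<noteq> h" "j \<noteq> 0" for j h :: nat
  proof -
    have "((j, 1), (h, 1)) \<in> (adj_rel TE)\<^sup>*"
      using T(2) that unfolding is_tree_def gconnected_def by blast
    from rtrancl_leaves_set[OF this, of "{v. fst v = j}"] that
    obtain a b where ab: "{a, b} \<in> TE" "fst a = j" "fst b \<noteq> j" by (auto simp: adj_rel_def)
    then have "b = (0, 0)" using glued_E_leave[of j "snd a" b] T(1) that by auto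
    then show ?thesis using ab by (cases a) auto
  qed
  obtain t1 where t1: "{(1, t1), (0, 0)} \<in> TE" using cut[of 1 2] T by auto
  obtain t2 where t2: "{(2, t2), (0, 0)} \<in> TE" using cut[of 2 1] T by auto
  obtain t3 where t3: "{(3, t3), (0, 0)} \<in> TE" using cut[of 3 1] T by auto
  let ?F = "{{(1 :: nat, t1), (0, 0)}, {(2, t2), (0, 0)}, {(3, t3), (0, 0)}}"
  have sub: "?F \<subseteq> TE" using t1 t2 t3 by simp
  have "inj_on c ?F"
  proof (rule inj_onI, rule ccontr)
    fix e g assume eg: "e \<in> ?F" "g \<in> ?F" "c e = c g" "e \<noteq> g"
    from eg(1,2) have "(0, 0) \<in> e \<inter> g" by auto
    then have "e \<inter> g \<noteq> {}" by blast
    then show False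
      using T(4) eg(3,4) subsetD[OF sub eg(1)] subsetD[OF sub eg(2)]
      unfolding proper_edges_def by simp
  qed
  moreover have "c ` ?F \<subseteq> {..<px3 ?V ?E}"
    using image_mono[OF order_trans[OF sub T(1)]] c(1) by (rule order_trans)
  ultimately have "card ?F \<le> card {..<px3 ?V ?E}"
    by (rule card_inj_on_le) simp
  moreover have "card ?F = 3" by (simp add: doubleton_eq_iff)
  ultimately show ?thesis by simp
qed

lemma px3_singleton: "px3 {v} {} = 0"
proof -
  have "has_proper_S_tree {v} {} c S" if "S \<subseteq> {v}" for c S
    unfolding has_proper_S_tree_def proper_edges_def using that is_tree_singleton[of v] by blast
  then have "three_proper {v} {} c" for c by (simp add: three_proper_def)
  then show ?thesis using px3_le[of "\<lambda>_. 0" "{}" 0 "{v}"] by simp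
qed

theorem theorem3p1:
  shows "(\<forall>(V :: 'a set) E D. sgraph V E \<and> gconnected V E \<and> D \<subseteq> V \<and>
            connected_three_way_dominating V E D \<longrightarrow>
            px3 V E \<le> px3 D (induced_edges E D) + 3)
       \<and> (\<forall>(p :: nat) (i :: nat \<Rightarrow> nat). p \<ge> 3 \<and> (\<forall>j\<in>{1..p}. i j \<ge> 4) \<longrightarrow>
            connected_three_way_dominating (glued_V p i) (glued_E p i) {(0, 0)} \<and>
            px3 (glued_V p i) (glued_E p i) = 3 \<and>
            px3 {(0, 0)} (induced_edges (glued_E p i) {(0, 0)}) + 3 = 3)"
proof (intro conjI allI impI)
  fix V :: "'a set" and E D
  assume "sgraph V E \<and> gconnected V E \<and> D \<subseteq> V \<and> connected_three_way_dominating V E D"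
  then show "px3 V E \<le> px3 D (induced_edges E D) + 3"
    using px3_three_way_dominating by blast
next
  fix p :: nat and i :: "nat \<Rightarrow> nat"
  assume a: "p \<ge> 3 \<and> (\<forall>j\<in>{1..p}. i j \<ge> 4)"
  show dom: "connected_three_way_dominating (glued_V p i) (glued_E p i) {(0, 0)}"
    using a by (intro glued_dominating) auto
  have "induced_edges (glued_E p i) {(0, 0)} = {}"
    by (auto simp: induced_edges_def glued_E_def)
  then have zero: "px3 {(0, 0)} (induced_edges (glued_E p i) {(0, 0)}) = 0"
    by (simp add: px3_singleton)
  then show "px3 {(0, 0)} (induced_edges (glued_E p i) {(0, 0)}) + 3 = 3" by simp
  have "{(0, 0)} \<subseteq> glued_V p i" using a by (simp add: glued_V_iff)
  \<comment> \<open>This is the general bound for \<open>D = {(0, 0)}\<close>, whose induced graph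
    needs no colour.\<close>
  then have "px3 (glued_V p i) (glued_E p i) \<le> 3"
    using px3_three_way_dominating[OF sgraph_glued _ dom] zero by simp
  then show "px3 (glued_V p i) (glued_E p i) = 3"
    using px3_glued_ge a by (simp add: le_antisym)
qed

end
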